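(* Let $p=3$. Then the permutations of $\mathbb{F}_3$ induced by $D_2(1,x)$ and by $D_{2p}(1,x)=D_6(1,x)$ both have cycle type $(3)$, i.e. each is a single cycle of length $3$.
   Context: The $n$th reversed Dickson polynomial of the first kind (with parameter $1$) is the integer-coefficient polynomial $D_n(1,x)$ defined by $D_0(1,x)=2$, $D_1(1,x)=1$, $D_n(1,x)=D_{n-1}(1,x)-x\,D_{n-2}(1,x)$ for $n\ge 2$. Coefficients are reduced modulo $3$ to regard it as a polynomial over $\mathbb{F}_3$. The cycle type of a permutation is the multiset of lengths of the cycles in its disjoint cycle decomposition, fixed points being counted as cycles of length $1$. *)

theory Defs
  imports
    "HOL-Computational_Algebra.Polynomial"
    "HOL-Combinatorics.Cycles"
    "HOL-Combinatorics.Orbits"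
    "HOL-Library.Multiset"
begin

text \<open>Reversed Dickson polynomials \<open>D\<^sub>n(1, x)\<close> of the first kind: the parameter is fixed to 1.\<close>

fun reversed_dickson :: "nat \<Rightarrow> int poly" where
  "reversed_dickson 0 = 2"
| "reversed_dickson (Suc 0) = 1"
| "reversed_dickson (Suc (Suc n)) = reversed_dickson (Suc n) - [:0, 1:] * reversed_dickson n"

definition reversed_dickson_over :: "nat \<Rightarrow> 'a::comm_ring_1 poly" where
  "reversed_dickson_over n = map_poly of_int (reversed_dickson n)"

text \<open>
  The list of lists \<open>css\<close> writes \<open>p\<close> as a product of disjoint cycles that together cover \<open>S\<close>;
  a fixed point of \<open>p\<close> in \<open>S\<close> has to occur, as a list of length one.
\<close>

definition disjoint_cycle_decomp :: "'a set \<Rightarrow> ('a \<Rightarrow> 'a) \<Rightarrow> 'a list list \<Rightarrow> bool" where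
  "disjoint_cycle_decomp S p css \<longleftrightarrow>
     [] \<notin> set css \<and> distinct (concat css) \<and> set (concat css) = S \<and>
     p = foldr (\<circ>) (map cycle_of_list css) id"

text \<open>
  Meaningful when \<open>p\<close> permutes the finite set \<open>S\<close>: the decomposition then exists, and all
  decompositions have the same lengths (\<open>disjoint_cycle_decomp_exists\<close>, \<open>cycle_type_eq\<close> below).
\<close>

definition cycle_type :: "'a set \<Rightarrow> ('a \<Rightarrow> 'a) \<Rightarrow> nat multiset" where
  "cycle_type S p = (THE M. \<exists>css. disjoint_cycle_decomp S p css \<and> M = mset (map length css))"

lemma disjoint_cycle_decomp_exists:
  assumes "p permutes S" and "finite S"
  shows "\<exists>css. disjoint_cycle_decomp S p css"
proof -
  have "cycle_decomp S p"
    using assms by (rule cycle_decomposition)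
  then show ?thesis
  proof (induction rule: cycle_decomp.induct)
    case empty
    then show ?case
      unfolding disjoint_cycle_decomp_def by (intro exI[of _ "[]"]) (simp add: id_def)
  next
    case (comp I p cs)
    then obtain css where css: "disjoint_cycle_decomp I p css"
      by blast
    show ?case
    proof (cases "cs = []")
      case True
      with css show ?thesis by auto
    next
      case False
      with css comp.hyps have "disjoint_cycle_decomp (set cs \<union> I) (cycle_of_list cs \<circ> p) (cs # css)"
        by (auto simp: disjoint_cycle_decomp_def)
      then show ?thesis by blast
    qed
  qed
qed

lemma foldr_cycles_outside:
  assumes "x \<notin> set (concat css)"
  shows "foldr (\<circ>) (map cycle_of_list css) id x = x"
  using assms by (induction css) (auto simp: id_outside_supp)

lemma cycle_of_list_in_set:
  assumes "x \<in> set c"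
  shows "cycle_of_list c x \<in> set c"
  using assms permutes_in_image[OF cycle_permutes] by metis

lemma foldr_cycles_inside:
  assumes "distinct (concat css)" and "c \<in> set css" and "x \<in> set c"
  shows "foldr (\<circ>) (map cycle_of_list css) id x = cycle_of_list c x"
  using assms
proof (induction css)
  case Nil
  then show ?case by simp
next
  case (Cons d ds)
  show ?case
  proof (cases "x \<in> set d")
    case True
    then have "x \<notin> set (concat ds)"
      using Cons.prems by auto
    moreover from this have "c = d"
      using Cons.prems by auto
    moreover from calculation(1) have "foldr (\<circ>) (map cycle_of_list ds) id x = x"
      by (rule foldr_cycles_outside)
    ultimately show ?thesis
      by (simp add: comp_def[abs_def] id_def)
  next
    case False
    then have c: "c \<in> set ds"
      using Cons.prems by auto
    have "cycle_of_list c x \<in> set c"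
      using Cons.prems(3) by (rule cycle_of_list_in_set)
    then have "cycle_of_list c x \<notin> set d"
      using Cons.prems c by auto
    then show ?thesis
      using Cons c by (auto simp: id_outside_supp)
  qed
qed

lemma orbit_cycle_of_list:
  assumes "distinct c" and "x \<in> set c"
    and eq: "\<And>y. y \<in> set c \<Longrightarrow> p y = cycle_of_list c y"
  shows "orbit p x = set c"
proof -
  let ?n = "length c"
  obtain i where i: "i < ?n" "x = c ! i"
    using assms(2) by (auto simp: in_set_conv_nth)
  have mem: "(cycle_of_list c ^^ n) x \<in> set c" for n
    by (induction n) (auto simp: assms(2) cycle_of_list_in_set)
  have pow: "(p ^^ n) x = c ! ((n + i) mod ?n)" for n
  proof -
    have "(p ^^ n) x = (cycle_of_list c ^^ n) x"
      by (induction n) (auto simp: eq mem)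
    also have "\<dots> = map (cycle_of_list c ^^ n) c ! i"
      using i by simp
    also have "\<dots> = rotate n c ! i"
      using cyclic_rotation[OF assms(1)] by simp
    also have "\<dots> = c ! ((n + i) mod ?n)"
      using i by (simp add: nth_rotate)
    finally show ?thesis .
  qed
  have "set c \<subseteq> orbit p x"
  proof
    fix y assume "y \<in> set c"
    then obtain j where j: "j < ?n" "y = c ! j"
      by (auto simp: in_set_conv_nth)
    have "(j + ?n - i + ?n + i) mod ?n = j"
      using i j by simp
    then have "(p ^^ (j + ?n - i + ?n)) x = y"
      using j by (simp add: pow)
    moreover have "0 < j + ?n - i + ?n"
      using j by linarith
    ultimately show "y \<in> orbit p x"
      unfolding orbit_altdef by blast
  qed
  moreover have "orbit p x \<subseteq> set c"
  proof
    fix y assume "y \<in> orbit p x"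
    then obtain n where "y = c ! ((n + i) mod ?n)"
      unfolding orbit_altdef pow by blast
    then show "y \<in> set c"
      using i by (metis length_pos_if_in_set assms(2) mod_less_divisor nth_mem)
  qed
  ultimately show ?thesis by blast
qed

lemma disjoint_cycle_decomp_lengths:
  assumes "disjoint_cycle_decomp S p css"
  shows "mset (map length css) = image_mset card (mset_set (orbit p ` S))"
proof -
  have ne: "[] \<notin> set css" and d: "distinct (concat css)" and S: "set (concat css) = S"
    and p: "p = foldr (\<circ>) (map cycle_of_list css) id"
    using assms by (auto simp: disjoint_cycle_decomp_def)
  have orb: "orbit p x = set c" if "c \<in> set css" "x \<in> set c" for c x
  proof (rule orbit_cycle_of_list)
    show "distinct c"
      using d that(1) by (simp add: distinct_concat_iff)
    show "p y = cycle_of_list c y" if "y \<in> set c" for y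
      unfolding p using d \<open>c \<in> set css\<close> that by (rule foldr_cycles_inside)
  qed (fact that(2))
  have "distinct (map set css)"
    using ne d
  proof (induction css)
    case (Cons c ds)
    have "set c \<noteq> set e" if "e \<in> set ds" for e
    proof
      assume "set c = set e"
      moreover have "set c \<inter> set e = {}"
        using Cons.prems(2) that by auto
      ultimately show False
        using Cons.prems(1) by simp
    qed
    then show ?case
      using Cons by auto
  qed simp
  moreover have "set (map set css) = orbit p ` S"
  proof
    show "set (map set css) \<subseteq> orbit p ` S"
    proof
      fix A assume "A \<in> set (map set css)"
      then obtain c where c: "c \<in> set css" "A = set c" by auto
      then obtain x where "x \<in> set c" using ne by (metis list.set_sel(1))
      then show "A \<in> orbit p ` S"
        using c S orb[of c x] by (auto intro!: image_eqI[of _ _ x])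
    qed
    show "orbit p ` S \<subseteq> set (map set css)"
    proof
      fix A assume "A \<in> orbit p ` S"
      then obtain x where x: "x \<in> S" "A = orbit p x" by blast
      then obtain c where "c \<in> set css" "x \<in> set c" using S by auto
      then show "A \<in> set (map set css)"
        using orb x by simp
    qed
  qed
  ultimately have "mset (map set css) = mset_set (orbit p ` S)"
    by (metis mset_set_set)
  moreover have "map length css = map card (map set css)"
    using d by (auto simp: distinct_card distinct_concat_iff)
  ultimately show ?thesis
    by (metis mset_map)
qed

lemma cycle_type_eq:
  assumes "disjoint_cycle_decomp S p css"
  shows "cycle_type S p = mset (map length css)"
  unfolding cycle_type_def
proof (intro the_equality)
  show "\<exists>css'. disjoint_cycle_decomp S p css' \<and> mset (map length css) = mset (map length css')"
    using assms by blast
next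
  fix M
  assume "\<exists>css'. disjoint_cycle_decomp S p css' \<and> M = mset (map length css')"
  then obtain css' where "disjoint_cycle_decomp S p css'" "M = mset (map length css')"
    by blast
  then show "M = mset (map length css)"
    by (simp only: disjoint_cycle_decomp_lengths[OF assms] disjoint_cycle_decomp_lengths)
qed

end

theory Submission
  imports Defs
begin

text \<open>
  Modulo 3, \<open>D\<^sub>2 = 1 - 2 x\<close> and \<open>D\<^sub>6 = 1 - 6 x + 9 x^2 - 2 x^3\<close> become \<open>1 + x\<close> and \<open>1 + x^3\<close>. By
  Fermat both induce the translation \<open>x \<mapsto> x + 1\<close> on the field with three elements, which is the
  cycle \<open>(0 1 2)\<close>.
\<close>

lemma of_nat_card_UNIV:
  assumes "finite (UNIV :: 'a::ring_1 set)"
  shows "of_nat (card (UNIV :: 'a set)) = (0 :: 'a)"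
proof -
  \<comment> \<open>Translation by 1 permutes the summands of the sum of all elements.\<close>
  have "(\<Sum>x\<in>UNIV. x + 1 :: 'a) = (\<Sum>x\<in>UNIV. x)"
    by (rule sum.reindex_bij_witness[where i = "\<lambda>x. x - 1" and j = "\<lambda>x. x + 1"]) auto
  then show ?thesis
    by (simp add: sum.distrib)
qed

lemma two_neq_one: "(2 :: 'a::ring_1) \<noteq> 1"
  by (metis add_left_cancel one_add_one add.right_neutral zero_neq_one)

context
  assumes card: "card (UNIV :: 'a::field set) = 3"
begin

text \<open>Only the number of elements is assumed, so characteristic 3 has to be derived from
  it.\<close>

lemma three_eq_zero: "(3 :: 'a) = 0"
proof -
  have "finite (UNIV :: 'a set)"
    using card by (intro card_ge_0_finite) simp
  from of_nat_card_UNIV[OF this] show ?thesis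
    by (simp add: card)
qed

lemma two_eq_minus_one: "(2 :: 'a) = - 1"
  using three_eq_zero by (simp add: eq_neg_iff_add_eq_0)

lemma two_neq_zero: "(2 :: 'a) \<noteq> 0"
  by (simp add: two_eq_minus_one)

text \<open>Three distinct elements exhaust a set of size three. Claims about all \<open>x\<close>
  thus become three checks.\<close>

lemma UNIV_eq: "UNIV = {0, 1, 2 :: 'a}"
proof -
  have "card {0, 1, 2 :: 'a} = card (UNIV :: 'a set)"
    using card two_neq_zero by (simp add: two_neq_one two_neq_one[symmetric])
  moreover have "finite (UNIV :: 'a set)"
    using card by (intro card_ge_0_finite) simp
  ultimately show ?thesis
    using card_subset_eq[of UNIV "{0, 1, 2 :: 'a}"] by simp
qed

text \<open>With 2 read as -1, each of 0, 1, -1 is its own cube.\<close>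

lemma cube_eq: "(x :: 'a) ^ 3 = x"
proof -
  have "x \<in> {0, 1, 2}"
    using UNIV_eq by blast
  then show ?thesis
    by (auto simp: two_eq_minus_one)
qed

lemma translation_eq_cycle: "(\<lambda>x :: 'a. x + 1) = cycle_of_list [0, 1, 2]"
proof
  fix x :: 'a
  have "x \<in> {0, 1, 2}"
    using UNIV_eq by blast
  then show "x + 1 = cycle_of_list [0, 1, 2] x"
    \<comment> \<open>The cycle unfolds to the transposition of 0 and 1 after that of 1 and 2;
      \<open>three_eq_zero\<close> closes it up at 2 + 1 = 0.\<close>
    using two_neq_zero three_eq_zero by (auto simp: transpose_def two_neq_one)
qed

lemma translation_permutes: "(\<lambda>x :: 'a. x + 1) permutes UNIV"
  unfolding translation_eq_cycle by (rule permutes_subset[OF cycle_permutes]) simp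

lemma cycle_type_translation: "cycle_type UNIV (\<lambda>x :: 'a. x + 1) = {#3#}"
proof -
  have "disjoint_cycle_decomp UNIV (\<lambda>x :: 'a. x + 1) [[0, 1, 2]]"
    unfolding disjoint_cycle_decomp_def translation_eq_cycle
    using two_neq_zero UNIV_eq by (auto simp: two_neq_one two_neq_one[symmetric])
  then show ?thesis
    by (simp add: cycle_type_eq)
qed

end

text \<open>The recurrence is run over the integers, so the formula holds in every commutative ring;
  reduction modulo 3 comes later.\<close>

lemma poly_reversed_dickson_over_2:
  "poly (reversed_dickson_over 2 :: 'a::comm_ring_1 poly) x = 1 - 2 * x"
proof -
  have "reversed_dickson 2 = [:1, -2:]"
    by (simp add: numeral_2_eq_2 one_pCons numeral_poly)
  then show ?thesis
    by (simp add: reversed_dickson_over_def map_poly_pCons)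
qed

lemma poly_reversed_dickson_over_6:
  "poly (reversed_dickson_over 6 :: 'a::comm_ring_1 poly) x = 1 - 6 * x + 9 * x ^ 2 - 2 * x ^ 3"
proof -
  have "reversed_dickson 6 = [:1, -6, 9, -2:]"
    by (simp add: eval_nat_numeral one_pCons numeral_poly)
  then show ?thesis
    by (simp add: reversed_dickson_over_def map_poly_pCons algebra_simps power2_eq_square power3_eq_cube)
qed

theorem theorem3p10:
  fixes p :: nat
  assumes "p = 3" and "card (UNIV :: 'a::field set) = p"
  shows "poly (reversed_dickson_over 2 :: 'a poly) permutes UNIV \<and>
         cycle_type UNIV (poly (reversed_dickson_over 2 :: 'a poly)) = {#3#} \<and>
         poly (reversed_dickson_over (2 * p) :: 'a poly) permutes UNIV \<and>
         cycle_type UNIV (poly (reversed_dickson_over (2 * p) :: 'a poly)) = {#3#}"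
proof -
  have card: "card (UNIV :: 'a set) = 3"
    using assms by simp
  note two = two_eq_minus_one[OF card]
  \<comment> \<open>The factor 3 is exposed so that \<open>three_eq_zero\<close> can rewrite
    it.\<close>
  have "(6 :: 'a) = 2 * 3" "(9 :: 'a) = 3 * 3"
    by simp_all
  then have zero: "(6 :: 'a) = 0" "(9 :: 'a) = 0"
    unfolding three_eq_zero[OF card] by simp_all
  have "poly (reversed_dickson_over 2 :: 'a poly) = (\<lambda>x. x + 1)"
    by (simp add: fun_eq_iff poly_reversed_dickson_over_2 two)
  \<comment> \<open>The middle terms vanish, and -2 x^3 = x^3 = x.\<close>
  moreover have "poly (reversed_dickson_over (2 * p) :: 'a poly) = (\<lambda>x. x + 1)"
    by (simp add: fun_eq_iff assms(1) poly_reversed_dickson_over_6 zero two cube_eq[OF card])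
  ultimately show ?thesis
    using translation_permutes[OF card] cycle_type_translation[OF card] by simp
qed

end
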